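(* Let $n\ge 4$ and let $QD_{2^n} = \langle a,b : a^{2^{n-1}} = b^2 = 1,\ bab^{-1} = a^{2^{n-2}-1}\rangle$ be the quasidihedral group. Then the spectrum of its commuting graph is $$\operatorname{Spec}(\Gamma_{QD_{2^n}}) = \left\{(-1)^{2^n-2^{n-2}-3},\ 1^{2^{n-2}},\ (2^{n-1}-3)^1\right\}.$$
   Context: For a finite non-abelian group $G$ with centre $Z(G)$, the commuting graph $\Gamma_G$ is the simple undirected graph with vertex set $G\setminus Z(G)$ in which two distinct vertices $x,y$ are adjacent if and only if $xy=yx$. The spectrum $\operatorname{Spec}$ of a graph is the multiset of eigenvalues of its adjacency matrix, written $\{\lambda_1^{k_1},\dots,\lambda_r^{k_r}\}$, where $\lambda^{k}$ denotes that $\lambda$ is listed $k$ times (listed values may coincide, in which case multiplicities add). *)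

theory Defs
  imports
    "HOL-Algebra.Group"
    "HOL-Computational_Algebra.Computational_Algebra"
    "Jordan_Normal_Form.Char_Poly"
    "Graph_Theory.Pair_Digraph"
begin

section \<open>Groups given by generators and relations\<close>

text \<open>A word is a list of letters; the letter \<open>(g, True)\<close> stands for the generator \<open>g\<close> and
  \<open>(g, False)\<close> for its formal inverse. A relation \<open>u = v\<close> is the pair \<open>(u, v)\<close>.\<close>

type_synonym 'g word = "('g \<times> bool) list"

definition gen :: "'g \<Rightarrow> 'g word" where
  "gen g = [(g, True)]"

definition gen_inv :: "'g \<Rightarrow> 'g word" where
  "gen_inv g = [(g, False)]"

definition word_pow :: "'g word \<Rightarrow> nat \<Rightarrow> 'g word" where
  "word_pow w k = concat (replicate k w)"

inductive pres_eq :: "('g word \<times> 'g word) set \<Rightarrow> 'g word \<Rightarrow> 'g word \<Rightarrow> bool"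
  for R where
  cancel: "pres_eq R [(g, s), (g, \<not> s)] []"
| relation: "(u, v) \<in> R \<Longrightarrow> pres_eq R u v"
| refl: "pres_eq R u u"
| sym: "pres_eq R u v \<Longrightarrow> pres_eq R v u"
| trans: "pres_eq R u v \<Longrightarrow> pres_eq R v w \<Longrightarrow> pres_eq R u w"
| append: "pres_eq R u u' \<Longrightarrow> pres_eq R v v' \<Longrightarrow> pres_eq R (u @ v) (u' @ v')"

definition pres_class :: "('g word \<times> 'g word) set \<Rightarrow> 'g word \<Rightarrow> 'g word set" where
  "pres_class R u = {v. pres_eq R u v}"

text \<open>The generators are all elements of the type \<open>'g\<close>.\<close>

definition presented_group :: "('g word \<times> 'g word) set \<Rightarrow> 'g word set monoid" where
  "presented_group R =
    \<lparr>carrier = range (pres_class R),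
     mult = (\<lambda>X Y. \<Union>u\<in>X. \<Union>v\<in>Y. pres_class R (u @ v)),
     one = pres_class R []\<rparr>"

lemma pres_class_eq_iff: "pres_class R u = pres_class R v \<longleftrightarrow> pres_eq R u v"
proof
  assume "pres_class R u = pres_class R v"
  then show "pres_eq R u v"
    using pres_eq.refl[of R v] by (auto simp: pres_class_def)
next
  assume uv: "pres_eq R u v"
  have "pres_eq R u w \<longleftrightarrow> pres_eq R v w" for w
    using pres_eq.trans[OF uv, of w] pres_eq.trans[OF pres_eq.sym[OF uv], of w] by blast
  then show "pres_class R u = pres_class R v"
    by (simp add: pres_class_def)
qed

lemma presented_group_mult:
  "pres_class R u \<otimes>\<^bsub>presented_group R\<^esub> pres_class R v = pres_class R (u @ v)"
proof -
  have "pres_class R (u' @ v') = pres_class R (u @ v)"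
    if "u' \<in> pres_class R u" "v' \<in> pres_class R v" for u' v'
  proof -
    have "pres_eq R u u'" "pres_eq R v v'"
      using that by (simp_all add: pres_class_def)
    then show ?thesis
      unfolding pres_class_eq_iff by (rule pres_eq.sym[OF pres_eq.append])
  qed
  moreover have "u \<in> pres_class R u" "v \<in> pres_class R v"
    by (simp_all add: pres_class_def pres_eq.refl)
  ultimately have "(\<Union>u'\<in>pres_class R u. \<Union>v'\<in>pres_class R v. pres_class R (u' @ v')) =
      pres_class R (u @ v)"
    by blast
  then show ?thesis
    by (simp add: presented_group_def)
qed

lemma pres_eq_inverse_word:
  "pres_eq R (rev (map (\<lambda>(g, s). (g, \<not> s)) w) @ w) []"
proof (induction w)
  case Nil
  show ?case by (simp add: pres_eq.refl)
next
  case (Cons x w)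
  obtain g s where x: "x = (g, s)" by force
  let ?i = "rev (map (\<lambda>(g, s). (g, \<not> s)) w)"
  have "pres_eq R [(g, \<not> s), (g, s)] []"
    using pres_eq.cancel[of R g "\<not> s"] by simp
  then have "pres_eq R (?i @ ([(g, \<not> s), (g, s)] @ w)) (?i @ ([] @ w))"
    by (intro pres_eq.append pres_eq.refl)
  then have "pres_eq R (rev (map (\<lambda>(g, s). (g, \<not> s)) (x # w)) @ x # w) (?i @ w)"
    by (simp add: x)
  then show ?case
    using Cons.IH by (rule pres_eq.trans)
qed

lemma presented_group_is_group: "group (presented_group R)"
proof (rule groupI)
  let ?G = "presented_group R"
  have carrier: "carrier ?G = range (pres_class R)" and one: "\<one>\<^bsub>?G\<^esub> = pres_class R []"
    by (simp_all add: presented_group_def)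
  show "x \<otimes>\<^bsub>?G\<^esub> y \<in> carrier ?G" if "x \<in> carrier ?G" "y \<in> carrier ?G" for x y
    using that by (auto simp: carrier presented_group_mult)
  show "\<one>\<^bsub>?G\<^esub> \<in> carrier ?G"
    by (simp add: carrier one)
  show "x \<otimes>\<^bsub>?G\<^esub> y \<otimes>\<^bsub>?G\<^esub> z = x \<otimes>\<^bsub>?G\<^esub> (y \<otimes>\<^bsub>?G\<^esub> z)"
    if "x \<in> carrier ?G" "y \<in> carrier ?G" "z \<in> carrier ?G" for x y z
    using that by (auto simp: carrier presented_group_mult)
  show "\<one>\<^bsub>?G\<^esub> \<otimes>\<^bsub>?G\<^esub> x = x" if "x \<in> carrier ?G" for x
    using that by (auto simp: carrier one presented_group_mult)
  show "\<exists>y\<in>carrier ?G. y \<otimes>\<^bsub>?G\<^esub> x = \<one>\<^bsub>?G\<^esub>" if x: "x \<in> carrier ?G" for x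
  proof -
    obtain w where "x = pres_class R w" using x by (auto simp: carrier)
    then have "pres_class R (rev (map (\<lambda>(g, s). (g, \<not> s)) w)) \<otimes>\<^bsub>?G\<^esub> x = \<one>\<^bsub>?G\<^esub>"
      by (simp add: one presented_group_mult pres_class_eq_iff pres_eq_inverse_word)
    then show ?thesis by (auto simp: carrier)
  qed
qed


section \<open>The quasidihedral group\<close>

datatype qd_gen = A | B

definition QD_relations :: "nat \<Rightarrow> (qd_gen word \<times> qd_gen word) set" where
  "QD_relations n =
    {(word_pow (gen A) (2 ^ (n - 1)), []),
     (word_pow (gen B) 2, []),
     (gen B @ gen A @ gen_inv B, word_pow (gen A) (2 ^ (n - 2) - 1))}"

text \<open>The parameter is the exponent: \<open>QD n\<close> is the group usually denoted by $QD_{2^n}$.\<close>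

definition QD :: "nat \<Rightarrow> qd_gen word set monoid" where
  "QD n = presented_group (QD_relations n)"


section \<open>Commuting graphs\<close>

definition group_center :: "('a, 'b) monoid_scheme \<Rightarrow> 'a set" where
  "group_center G = {z \<in> carrier G. \<forall>x\<in>carrier G. z \<otimes>\<^bsub>G\<^esub> x = x \<otimes>\<^bsub>G\<^esub> z}"

text \<open>An undirected edge is represented by its two orientations.\<close>

definition commuting_graph :: "('a, 'b) monoid_scheme \<Rightarrow> 'a pair_pre_digraph" where
  "commuting_graph G =
    \<lparr>pverts = carrier G - group_center G,
     parcs = {(x, y). x \<in> carrier G - group_center G \<and> y \<in> carrier G - group_center G \<and>
                      x \<noteq> y \<and> x \<otimes>\<^bsub>G\<^esub> y = y \<otimes>\<^bsub>G\<^esub> x}\<rparr>"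

lemma commuting_graph_pair_graph:
  assumes "finite (carrier G)"
  shows "pair_graph (commuting_graph G)"
proof
  show "finite (parcs (commuting_graph G))"
    by (rule finite_subset[of _ "carrier G \<times> carrier G"])
      (use assms in \<open>auto simp: commuting_graph_def\<close>)
qed (use assms in \<open>auto simp: commuting_graph_def symmetric_def sym_def arcs_ends_conv\<close>)


section \<open>Spectra of finite graphs\<close>

definition adjacency_mat :: "'a pair_pre_digraph \<Rightarrow> 'a list \<Rightarrow> complex mat" where
  "adjacency_mat D vs =
    mat (length vs) (length vs) (\<lambda>(i, j). if (vs ! i, vs ! j) \<in> parcs D then 1 else 0)"

definition eigenvalue_mset :: "complex mat \<Rightarrow> complex multiset" where
  "eigenvalue_mset M = proots (char_poly M)"

lemma set_eigenvalue_mset: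
  assumes "M \<in> carrier_mat n n"
  shows "set_mset (eigenvalue_mset M) = {k. eigenvalue M k}"
proof -
  have "char_poly M \<noteq> 0"
    using degree_monic_char_poly[OF assms] by auto
  then show ?thesis
    by (simp add: eigenvalue_mset_def eigenvalue_root_char_poly[OF assms])
qed

text \<open>Meaningful for graphs with finitely many vertices only. By \<open>graph_spectrum_eq\<close> below, the
  choice of the enumeration of the vertices is immaterial.\<close>

definition graph_spectrum :: "'a pair_pre_digraph \<Rightarrow> complex multiset" where
  "graph_spectrum D =
    eigenvalue_mset (adjacency_mat D (SOME vs. distinct vs \<and> set vs = pverts D))"

lemma similar_adjacency_mat:
  assumes "distinct vs" "distinct ws" "set vs = set ws"
  shows "similar_mat (adjacency_mat D vs) (adjacency_mat D ws)"
proof -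
  define n where "n = length ws"
  have len: "length vs = n" "length ws = n"
    using assms distinct_card[of vs] distinct_card[of ws] by (auto simp: n_def)
  define I :: "'a list \<Rightarrow> 'a list \<Rightarrow> complex mat" where
    "I xs ys = mat n n (\<lambda>(i, j). if xs ! i = ys ! j then 1 else 0)" for xs ys
  have reindex: "(\<Sum>k = 0..<n. f (ys ! k)) = (\<Sum>y\<in>set ys. f y)"
    if "distinct ys" "length ys = n" for ys :: "'a list" and f :: "'a \<Rightarrow> complex"
    using sum.reindex_bij_betw[OF bij_betw_nth[OF that(1)], of "{0..<n}" "set ys" f] that
    by (simp add: lessThan_atLeast0)
  have inverse: "I xs ys * I ys xs = 1\<^sub>m n"
    if d: "distinct xs" "distinct ys" "length xs = n" "length ys = n" "set xs = set ys" for xs ys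
  proof (rule eq_matI)
    fix i j assume ij: "i < dim_row (1\<^sub>m n)" "j < dim_col (1\<^sub>m n)"
    have "(I xs ys * I ys xs) $$ (i, j) =
        (\<Sum>k = 0..<n. (if xs ! i = ys ! k then 1 else 0) * (if ys ! k = xs ! j then 1 else 0))"
      using ij by (auto simp: I_def scalar_prod_def)
    also have "\<dots> = (\<Sum>y\<in>set ys. (if xs ! i = y then 1 else 0) * (if y = xs ! j then 1 else 0))"
      by (rule reindex[OF d(2,4)])
    also have "\<dots> = (\<Sum>y\<in>set ys. if xs ! i = y then (if y = xs ! j then 1 else 0) else 0)"
      by (rule sum.cong) auto
    also have "\<dots> = (if xs ! i = xs ! j then 1 else 0)"
      using ij d nth_mem[of i xs] by (simp add: sum.delta')
    also have "\<dots> = 1\<^sub>m n $$ (i, j)"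
      using ij d by (simp add: nth_eq_iff_index_eq)
    finally show "(I xs ys * I ys xs) $$ (i, j) = 1\<^sub>m n $$ (i, j)" .
  qed (auto simp: I_def)
  define a :: "'a \<Rightarrow> 'a \<Rightarrow> complex" where "a x y = (if (x, y) \<in> parcs D then 1 else 0)" for x y
  have adj: "adjacency_mat D xs = mat n n (\<lambda>(i, j). a (xs ! i) (xs ! j))" if "length xs = n" for xs
    using that by (simp add: adjacency_mat_def a_def)
  have left: "I vs ws * adjacency_mat D ws = mat n n (\<lambda>(i, j). a (vs ! i) (ws ! j))"
  proof (rule eq_matI)
    fix i j
    assume "i < dim_row (mat n n (\<lambda>(i, j). a (vs ! i) (ws ! j)))"
      "j < dim_col (mat n n (\<lambda>(i, j). a (vs ! i) (ws ! j)))"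
    then have ij: "i < n" "j < n" by auto
    have "(I vs ws * adjacency_mat D ws) $$ (i, j) =
        (\<Sum>k = 0..<n. (if vs ! i = ws ! k then 1 else 0) * a (ws ! k) (ws ! j))"
      using ij by (auto simp: I_def adj len scalar_prod_def)
    also have "\<dots> = (\<Sum>y\<in>set ws. (if vs ! i = y then 1 else 0) * a y (ws ! j))"
      by (rule reindex[OF assms(2) len(2)])
    also have "\<dots> = (\<Sum>y\<in>set ws. if vs ! i = y then a y (ws ! j) else 0)"
      by (rule sum.cong) auto
    also have "\<dots> = a (vs ! i) (ws ! j)"
      using ij len assms(3) nth_mem[of i vs] by (simp add: sum.delta')
    finally show "(I vs ws * adjacency_mat D ws) $$ (i, j) =
        mat n n (\<lambda>(i, j). a (vs ! i) (ws ! j)) $$ (i, j)"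
      using ij by simp
  qed (auto simp: I_def adj len)
  have right: "mat n n (\<lambda>(i, j). a (vs ! i) (ws ! j)) * I ws vs = adjacency_mat D vs"
  proof (rule eq_matI)
    fix i j
    assume "i < dim_row (adjacency_mat D vs)" "j < dim_col (adjacency_mat D vs)"
    then have ij: "i < n" "j < n" by (auto simp: adj len)
    have "(mat n n (\<lambda>(i, j). a (vs ! i) (ws ! j)) * I ws vs) $$ (i, j) =
        (\<Sum>k = 0..<n. a (vs ! i) (ws ! k) * (if ws ! k = vs ! j then 1 else 0))"
      using ij by (auto simp: I_def scalar_prod_def)
    also have "\<dots> = (\<Sum>y\<in>set ws. a (vs ! i) y * (if y = vs ! j then 1 else 0))"
      by (rule reindex[OF assms(2) len(2)])
    also have "\<dots> = (\<Sum>y\<in>set ws. if y = vs ! j then a (vs ! i) y else 0)"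
      by (rule sum.cong) auto
    also have "\<dots> = a (vs ! i) (vs ! j)"
      using ij len assms(3) nth_mem[of j vs] by (simp add: sum.delta)
    finally show "(mat n n (\<lambda>(i, j). a (vs ! i) (ws ! j)) * I ws vs) $$ (i, j) =
        adjacency_mat D vs $$ (i, j)"
      using ij by (simp add: adj len)
  qed (auto simp: I_def adj len)
  have dims: "adjacency_mat D vs \<in> carrier_mat n n" "adjacency_mat D ws \<in> carrier_mat n n"
    "I vs ws \<in> carrier_mat n n" "I ws vs \<in> carrier_mat n n"
    by (simp_all add: adjacency_mat_def I_def len)
  have "I vs ws * I ws vs = 1\<^sub>m n" "I ws vs * I vs ws = 1\<^sub>m n"
    by (rule inverse; simp add: assms len)+
  moreover have "adjacency_mat D vs = I vs ws * adjacency_mat D ws * I ws vs"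
    by (simp only: left right)
  ultimately have "similar_mat_wit (adjacency_mat D vs) (adjacency_mat D ws) (I vs ws) (I ws vs)"
    by (intro similar_mat_witI[OF _ _ _ dims]) simp_all
  then show ?thesis
    unfolding similar_mat_def by blast
qed

lemma graph_spectrum_eq:
  assumes "distinct vs" "set vs = pverts D"
  shows "graph_spectrum D = eigenvalue_mset (adjacency_mat D vs)"
proof -
  define ws where "ws = (SOME ws. distinct ws \<and> set ws = pverts D)"
  have "distinct ws \<and> set ws = pverts D"
    unfolding ws_def by (rule someI[of _ vs]) (simp add: assms)
  then have "similar_mat (adjacency_mat D ws) (adjacency_mat D vs)"
    using assms by (intro similar_adjacency_mat) simp_all
  then show ?thesis
    unfolding graph_spectrum_def eigenvalue_mset_def ws_def[symmetric]
    by (simp add: char_poly_similar)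
qed

end

theory Submission
  imports Defs "HOL-Number_Theory.Cong"
begin

text \<open>Put \<open>h = 2^(n - 2)\<close>. Every word equals some \<open>a^i b^s\<close>, where exactly \<open>i\<close>
  modulo \<open>2h\<close> and \<open>s\<close> modulo \<open>2\<close> are determined by the group element. Since \<open>b\<close> conjugates
  \<open>a\<close> to \<open>a^(h - 1)\<close> and \<open>h/2 - 1\<close> is odd, \<open>b\<close> commutes with \<open>a^i\<close> only if \<open>h\<close> divides \<open>i\<close>. So
  the centre is \<open>{1, a^h}\<close>, and two noncentral elements commute iff both are powers of \<open>a\<close> or they
  are \<open>a^i b\<close> and \<open>a^j b\<close> with \<open>i\<close> and \<open>j\<close> congruent modulo \<open>h\<close>. The commuting graph is therefore
  the disjoint union of one complete graph on \<open>2h - 2\<close> vertices and \<open>h\<close> complete graphs on two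
  vertices, and the complete graph on \<open>k\<close> vertices has the eigenvalue \<open>k - 1\<close> once and \<open>-1\<close>
  with multiplicity \<open>k - 1\<close>.\<close>

section \<open>Spectra of disjoint unions of complete graphs\<close>


text \<open>The matrix t I - M inherits the block shape, so the characteristic polynomial is a
  product. Both factors are monic, hence nonzero, and the root multisets add.\<close>

lemma eigenvalue_mset_block_diag:
  assumes M: "M \<in> carrier_mat k k" and N: "N \<in> carrier_mat l l"
  shows "eigenvalue_mset (four_block_mat M (0\<^sub>m k l) (0\<^sub>m l k) N) =
    eigenvalue_mset M + eigenvalue_mset N"
proof -
  have "char_poly_matrix (four_block_mat M (0\<^sub>m k l) (0\<^sub>m l k) N) =
      four_block_mat (char_poly_matrix M) (0\<^sub>m k l) (0\<^sub>m l k) (char_poly_matrix N)"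
    by (rule eq_matI) (use M N in \<open>auto simp: char_poly_matrix_def four_block_mat_def Let_def\<close>)
  then have "char_poly (four_block_mat M (0\<^sub>m k l) (0\<^sub>m l k) N) = char_poly M * char_poly N"
    unfolding char_poly_def
    using det_four_block_mat_upper_right_zero[of "char_poly_matrix M" k "0\<^sub>m k l" l "0\<^sub>m l k"
        "char_poly_matrix N"] M N
    by simp
  moreover have "char_poly M \<noteq> 0" "char_poly N \<noteq> 0"
    using degree_monic_char_poly[OF M] degree_monic_char_poly[OF N] by auto
  ultimately show ?thesis
    by (simp add: eigenvalue_mset_def proots_mult)
qed

text \<open>In the basis consisting of the all-ones vector and all but the first unit vector, the
  all-ones matrix becomes upper triangular.\<close>

lemma eigenvalue_mset_complete:
  assumes "k > 0"
  shows "eigenvalue_mset (mat k k (\<lambda>(i, j). if i = j then 0 else 1)) =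
    add_mset (of_nat k - 1) (replicate_mset (k - 1) (-1))"
proof -
  \<comment> \<open>The columns of \<open>P\<close> are the new basis and \<open>Q\<close> is its
    inverse. \<open>T\<close> is the all-ones matrix in that basis minus the identity, with diagonal
    k - 1, -1, ..., -1.\<close>
  define P Q T :: "complex mat" where
    "P = mat k k (\<lambda>(i, j). (if i = j then 1 else 0) + (if j = 0 \<and> i \<noteq> 0 then 1 else 0))" and
    "Q = mat k k (\<lambda>(i, j). (if i = j then 1 else 0) - (if j = 0 \<and> i \<noteq> 0 then 1 else 0))" and
    "T = mat k k (\<lambda>(i, j). (if i = 0 then (if j = 0 then of_nat k else 1) else 0) -
      (if i = j then 1 else 0))"
  let ?A = "mat k k (\<lambda>(i, j). if i = j then 0 else 1) :: complex mat"
  have mult: "mat k k f * mat k k g = mat k k (\<lambda>(i, j). \<Sum>l = 0..<k. f (i, l) * g (l, j))"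
    for f g :: "nat \<times> nat \<Rightarrow> complex"
    by (rule eq_matI) (auto simp: scalar_prod_def)
  have delta: "(if b then 1 else 0) * x = (if b then x else 0)"
    "x * (if b then 1 else 0) = (if b then x else 0)" for x :: complex and b
    by auto
  have conj0: "(if j = 0 \<and> c then x else 0) = (if j = 0 then (if c then x else 0) else 0)"
    for x :: complex and j :: nat and c
    by auto
  have PQ: "P * Q = 1\<^sub>m k" and QP: "Q * P = 1\<^sub>m k"
    unfolding P_def Q_def mult one_mat_def using assms
    by (auto intro!: eq_matI simp: algebra_simps sum.distrib sum_subtractf delta conj0
        sum.delta sum.delta' simp flip: sum_distrib_left sum_distrib_right cong: if_cong)
  have AP: "?A * P = P * T"
  proof -
    have ones: "(\<Sum>l = 0..<k. if 0 < l then 1 else 0 :: complex) = of_nat k - 1"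
    proof -
      have "(\<Sum>l = 0..<k. if 0 < l then 1 else 0 :: complex) =
          (\<Sum>l = 0..<k. 1 - (if l = 0 then 1 else 0))"
        by (rule sum.cong) auto
      also have "\<dots> = of_nat k - 1"
        using assms by (simp add: sum_subtractf)
      finally show ?thesis .
    qed
    have A: "?A = mat k k (\<lambda>(i, j). 1 - (if i = j then 1 else 0))"
      by (rule eq_matI) auto
    show ?thesis
      unfolding A P_def T_def mult using assms
      by (auto intro!: eq_matI simp: algebra_simps sum.distrib sum_subtractf delta conj0 ones
          sum.delta sum.delta' cong: if_cong)
  qed
  have "similar_mat_wit ?A T P Q"
  proof (rule similar_mat_witI[OF PQ QP])
    have "P * T * Q = ?A * P * Q" by (simp add: AP)
    also have "\<dots> = ?A * (P * Q)"
      by (rule assoc_mult_mat[of _ k k _ k _ k]) (auto simp: P_def Q_def)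
    finally show "?A = P * T * Q" by (simp add: PQ)
  qed (auto simp: P_def Q_def T_def)
  then have "char_poly ?A = char_poly T"
    using char_poly_similar similar_mat_def by blast
  also have "\<dots> = (\<Prod>a\<leftarrow>diag_mat T. [:- a, 1:])"
    by (rule char_poly_upper_triangular[of _ k]) (auto simp: T_def upper_triangular_def)
  also have "diag_mat T = (of_nat k - 1) # replicate (k - 1) (-1)"
    using assms by (auto simp: diag_mat_def T_def list_eq_iff_nth_eq nth_Cons split: nat.split)
  finally have "char_poly ?A = [:- (of_nat k - 1), 1:] * [:1, 1:] ^ (k - 1)"
    by (simp only: list.map prod_list.Cons map_replicate prod_list_replicate) simp
  moreover have "proots ([:- (of_nat k - 1), 1:] * [:1, 1:] ^ (k - 1) :: complex poly) =
      proots [:- (of_nat k - 1), 1:] + proots ([:1, 1:] ^ (k - 1))"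
    by (rule proots_mult) simp_all
  ultimately show ?thesis
    by (simp only: eigenvalue_mset_def proots_power proots_linear_factor repeat_mset_replicate_mset) simp
qed

section \<open>Adjacency matrices of disjoint cliques\<close>

lemma eigenvalue_mset_adjacency_clique:
  assumes "distinct c" "c \<noteq> []"
    and "\<And>x y. x \<in> set c \<Longrightarrow> y \<in> set c \<Longrightarrow> (x, y) \<in> parcs D \<longleftrightarrow> x \<noteq> y"
  shows "eigenvalue_mset (adjacency_mat D c) =
    add_mset (of_nat (length c) - 1) (replicate_mset (length c - 1) (-1))"
proof -
  have "adjacency_mat D c = mat (length c) (length c) (\<lambda>(i, j). if i = j then 0 else 1)"
    by (rule eq_matI) (use assms in \<open>auto simp: adjacency_mat_def nth_eq_iff_index_eq\<close>)
  with assms(2) show ?thesis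
    by (simp add: eigenvalue_mset_complete)
qed

text \<open>Without edges between \<open>vs\<close> and \<open>ws\<close> the two off-diagonal
  blocks vanish.\<close>

lemma eigenvalue_mset_adjacency_append:
  assumes "\<And>x y. x \<in> set vs \<Longrightarrow> y \<in> set ws \<Longrightarrow> (x, y) \<notin> parcs D \<and> (y, x) \<notin> parcs D"
  shows "eigenvalue_mset (adjacency_mat D (vs @ ws)) =
    eigenvalue_mset (adjacency_mat D vs) + eigenvalue_mset (adjacency_mat D ws)"
proof -
  let ?k = "length vs" and ?l = "length ws"
  have "adjacency_mat D (vs @ ws) =
      four_block_mat (adjacency_mat D vs) (0\<^sub>m ?k ?l) (0\<^sub>m ?l ?k) (adjacency_mat D ws)"
    by (rule eq_matI) (use assms in \<open>auto simp: adjacency_mat_def nth_append\<close>)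
  moreover have "adjacency_mat D vs \<in> carrier_mat ?k ?k" "adjacency_mat D ws \<in> carrier_mat ?l ?l"
    by (auto simp: adjacency_mat_def)
  ultimately show ?thesis
    by (simp add: eigenvalue_mset_block_diag)
qed

lemma eigenvalue_mset_adjacency_Nil: "eigenvalue_mset (adjacency_mat D []) = {#}"
proof -
  have "adjacency_mat D [] = 1\<^sub>m 0"
    by (rule eq_matI) (auto simp: adjacency_mat_def)
  then show ?thesis
    by (simp add: eigenvalue_mset_def char_poly_def char_poly_matrix_def)
qed

text \<open>Induction on the list of cliques: distinctness of the concatenation makes the first
  clique disjoint from the rest, so no edge joins them and the spectra add.\<close>

lemma eigenvalue_mset_adjacency_cliques:
  assumes "distinct (concat cs)" "[] \<notin> set cs"
    and "\<And>x y. x \<in> set (concat cs) \<Longrightarrow> y \<in> set (concat cs) \<Longrightarrow>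
      (x, y) \<in> parcs D \<longleftrightarrow> x \<noteq> y \<and> (\<exists>c\<in>set cs. x \<in> set c \<and> y \<in> set c)"
  shows "eigenvalue_mset (adjacency_mat D (concat cs)) =
    (\<Sum>c\<leftarrow>cs. add_mset (of_nat (length c) - 1) (replicate_mset (length c - 1) (-1)))"
  using assms
proof (induction cs)
  case Nil
  show ?case by (simp add: eigenvalue_mset_adjacency_Nil)
next
  case (Cons c cs)
  have disj: "set c \<inter> set (concat cs) = {}" and dist: "distinct (concat cs)" "distinct c"
    using Cons.prems(1) by auto
  have arcs: "(x, y) \<in> parcs D \<longleftrightarrow> x \<noteq> y \<and> (\<exists>d\<in>set (c # cs). x \<in> set d \<and> y \<in> set d)"
    if "x \<in> set c \<union> set (concat cs)" "y \<in> set c \<union> set (concat cs)" for x y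
    using Cons.prems(3)[of x y] that by simp
  have "eigenvalue_mset (adjacency_mat D c) =
      add_mset (of_nat (length c) - 1) (replicate_mset (length c - 1) (-1))"
  proof (rule eigenvalue_mset_adjacency_clique[OF dist(2)])
    show "c \<noteq> []" using Cons.prems(2) by auto
    show "(x, y) \<in> parcs D \<longleftrightarrow> x \<noteq> y" if "x \<in> set c" "y \<in> set c" for x y
      using arcs[of x y] that by auto
  qed
  moreover have "eigenvalue_mset (adjacency_mat D (concat cs)) =
      (\<Sum>c\<leftarrow>cs. add_mset (of_nat (length c) - 1) (replicate_mset (length c - 1) (-1)))"
  proof (rule Cons.IH[OF dist(1)])
    show "[] \<notin> set cs" using Cons.prems(2) by auto
    show "(x, y) \<in> parcs D \<longleftrightarrow> x \<noteq> y \<and> (\<exists>c\<in>set cs. x \<in> set c \<and> y \<in> set c)"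
      if "x \<in> set (concat cs)" "y \<in> set (concat cs)" for x y
      using arcs[of x y] that disj by auto
  qed
  moreover have "eigenvalue_mset (adjacency_mat D (c @ concat cs)) =
      eigenvalue_mset (adjacency_mat D c) + eigenvalue_mset (adjacency_mat D (concat cs))"
  proof (rule eigenvalue_mset_adjacency_append)
    show "(x, y) \<notin> parcs D \<and> (y, x) \<notin> parcs D" if "x \<in> set c" "y \<in> set (concat cs)" for x y
      using arcs[of x y] arcs[of y x] that disj by auto
  qed
  ultimately show ?case by simp
qed

section \<open>Normal forms in the quasidihedral group\<close>

text \<open>In the quasidihedral group, where \<open>b a b\<^sup>-\<^sup>1 = a\<^sup>r\<close>, the word \<open>w\<close> represents
  \<open>a ^ expo r w * b ^ count_B w\<close>.\<close>

fun count_B :: "qd_gen word \<Rightarrow> nat" where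
  "count_B [] = 0"
| "count_B ((A, s) # w) = count_B w"
| "count_B ((B, s) # w) = Suc (count_B w)"

text \<open>The exponent is a plain integer; reduction modulo the order of a is left to the
  comparison of words. The sign of a letter \<open>B\<close> is ignored because b is its own
  inverse.\<close>

fun expo :: "int \<Rightarrow> qd_gen word \<Rightarrow> int" where
  "expo r [] = 0"
| "expo r ((A, s) # w) = (if s then 1 else -1) + expo r w"
| "expo r ((B, s) # w) = r * expo r w"

lemma count_B_append: "count_B (u @ v) = count_B u + count_B v"
  by (induction u rule: count_B.induct) auto

text \<open>Each letter \<open>B\<close> of \<open>u\<close> that moves past the a-power of
  \<open>v\<close> multiplies its exponent by \<open>r\<close>.\<close>

lemma expo_append: "expo r (u @ v) = expo r u + r ^ count_B u * expo r v"
  by (induction u rule: count_B.induct) (auto simp: algebra_simps)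

lemma
  shows count_B_gen_A: "count_B (gen A) = 0" and expo_gen_A: "expo r (gen A) = 1"
    and count_B_gen_B: "count_B (gen B) = 1" and expo_gen_B: "expo r (gen B) = 0"
    and count_B_gen_inv_B: "count_B (gen_inv B) = 1" and expo_gen_inv_B: "expo r (gen_inv B) = 0"
  by (simp_all add: gen_def gen_inv_def)

lemma word_pow_Suc: "word_pow w (Suc k) = w @ word_pow w k"
  by (simp add: word_pow_def)

lemma word_pow_0: "word_pow w 0 = []"
  by (simp add: word_pow_def)

lemma
  shows count_B_pow_A: "count_B (word_pow (gen A) k) = 0"
    and expo_pow_A: "expo r (word_pow (gen A) k) = int k"
    and count_B_pow_B: "count_B (word_pow (gen B) k) = k"
    and expo_pow_B: "expo r (word_pow (gen B) k) = 0"
  by (induction k) (simp_all add: word_pow_Suc word_pow_0 gen_def)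

lemmas word_simps = count_B_append expo_append
  count_B_gen_A expo_gen_A count_B_gen_B expo_gen_B count_B_gen_inv_B expo_gen_inv_B
  count_B_pow_A expo_pow_A count_B_pow_B expo_pow_B

text \<open>The powers of an involution have period two. Hence the factor in
  \<open>expo_append\<close> is determined modulo m by the parity of \<open>count_B u\<close>
  alone.\<close>

lemma power_cong_parity:
  fixes r m :: int
  assumes "[r\<^sup>2 = 1] (mod m)" "even k = even l"
  shows "[r ^ k = r ^ l] (mod m)"
proof -
  have even: "[r ^ (2 * i) = 1] (mod m)" for i
    using cong_pow[OF assms(1), of i] by (simp add: power_mult)
  have "[r ^ k = r ^ (k mod 2)] (mod m)" for k
  proof -
    have "r ^ k = r ^ (2 * (k div 2)) * r ^ (k mod 2)"
      by (simp flip: power_add)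
    then show ?thesis
      using cong_scalar_right[OF even[of "k div 2"], of "r ^ (k mod 2)"] by simp
  qed
  moreover have "k mod 2 = l mod 2"
    using assms(2) by presburger
  ultimately show ?thesis
    by (metis cong_sym cong_trans)
qed

lemma (in group) mult_nat_pow_commute:
  assumes "x \<in> carrier G"
  shows "x \<otimes> x [^] (k::nat) = x [^] k \<otimes> x"
  using assms by (metis nat_pow_Suc nat_pow_Suc2)

section \<open>The exponent r modulo the order of a\<close>

locale quasidihedral =
  fixes n :: nat
  assumes n: "n \<ge> 4"
begin

abbreviation cls :: "qd_gen word \<Rightarrow> qd_gen word set" where
  "cls \<equiv> pres_class (QD_relations n)"

definition r :: int where "r = 2 ^ (n - 2) - 1"

definition half :: nat where "half = 2 ^ (n - 2)"

lemma half_ge: "half \<ge> 4"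
  using power_increasing[of 2 "n - 2" "2::nat"] n by (simp add: half_def)

lemma order_A: "(2::nat) ^ (n - 1) = 2 * half"
  using n by (simp add: half_def Suc_diff_le flip: power_Suc)

lemma r_half: "r = int half - 1"
  by (simp add: r_def half_def)

text \<open>With h = 2q, (h - 1)^2 - 1 = h (h - 2) = 2h (q - 1).\<close>

lemma r_squared: "[r\<^sup>2 = 1] (mod int (2 * half))"
proof -
  have "even half"
    using n by (simp add: half_def)
  then obtain q where "half = 2 * q" ..
  then have "r\<^sup>2 - 1 = int (2 * half) * (int q - 1)"
    by (simp add: r_half power2_eq_square algebra_simps)
  then show ?thesis
    by (simp add: cong_iff_dvd_diff)
qed

text \<open>With h = 2q, r - 1 = 2 (q - 1). Cancelling 2 leaves the modulus 2q and the factor q - 1,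
  and these are coprime because \<open>n \<ge> 4\<close> makes q even.\<close>

lemma r_minus_one_dvd_iff: "int (2 * half) dvd (r - 1) * x \<longleftrightarrow> int half dvd x"
proof -
  define q where "q = (2::int) ^ (n - 3)"
  have h: "int half = 2 * q"
    using n by (simp add: half_def q_def Suc_diff_le flip: power_Suc)
  have "even q"
    using n by (simp add: q_def)
  have "(r - 1) * x = 2 * ((q - 1) * x)"
    by (simp add: r_half h algebra_simps)
  then have "int (2 * half) dvd (r - 1) * x \<longleftrightarrow> 2 * q dvd (q - 1) * x"
    by (simp only: h of_nat_mult of_nat_numeral dvd_mult_cancel_left) simp
  also have "\<dots> \<longleftrightarrow> 2 * q dvd x"
  proof (rule coprime_dvd_mult_right_iff)
    have "coprime q (q - 1)"
      by (metis coprime_diff_one_left coprime_commute)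
    moreover have "coprime 2 (q - 1)"
      using \<open>even q\<close> by simp
    ultimately show "coprime (2 * q) (q - 1)"
      by simp
  qed
  finally show ?thesis by (simp add: h)
qed

text \<open>Rule induction: each rule generating \<open>pres_eq\<close> preserves both invariants.
  Words that differ in an invariant thus stay distinct in the quotient, without recourse to a
  concrete model of the group.\<close>

lemma pres_eq_invariants:
  assumes "pres_eq (QD_relations n) u v"
  shows "[expo r u = expo r v] (mod int (2 * half)) \<and> even (count_B u) = even (count_B v)"
  using assms
proof induction
  case (cancel g s)
  show ?case
    by (cases g) simp_all
next
  case (relation u v)
  have "(2::int) ^ (n - 1) = 2 * int half"
    using order_A by (metis of_nat_mult of_nat_numeral of_nat_power)
  with relation half_ge show ?case
    by (auto simp: QD_relations_def word_simps r_half half_def[symmetric] cong_iff_dvd_diff of_nat_diff)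
next
  case (append u u' v v')
  \<comment> \<open>Only the parity of \<open>count_B u\<close> is invariant, which is enough for
    the factor in \<open>expo_append\<close>.\<close>
  have "[r ^ count_B u = r ^ count_B u'] (mod int (2 * half))"
    using append.IH(1) by (intro power_cong_parity r_squared) simp
  then show ?case
    using append.IH by (auto simp: expo_append count_B_append intro!: cong_add cong_mult)
qed (auto intro: cong_sym cong_trans)

section \<open>Consequences of the defining relations\<close>

lemma group_QD: "group (QD n)"
  by (simp add: QD_def presented_group_is_group)

lemma cls_closed: "cls w \<in> carrier (QD n)"
  by (simp add: QD_def presented_group_def)

lemma cls_append: "cls (u @ v) = cls u \<otimes>\<^bsub>QD n\<^esub> cls v"
  by (simp add: QD_def presented_group_mult)

lemma cls_Nil: "cls [] = \<one>\<^bsub>QD n\<^esub>"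
  by (simp add: QD_def presented_group_def)

lemma cls_relation: "(u, v) \<in> QD_relations n \<Longrightarrow> cls u = cls v"
  by (simp add: pres_class_eq_iff pres_eq.relation)

interpretation QD: group "QD n"
  by (rule group_QD)

lemma cls_word_pow: "cls (word_pow w k) = cls w [^]\<^bsub>QD n\<^esub> k"
  by (induction k)
    (simp_all add: word_pow_Suc word_pow_0 cls_append cls_Nil cls_closed QD.mult_nat_pow_commute)

lemma cls_gen_inv: "cls (gen_inv g) = inv\<^bsub>QD n\<^esub> (cls (gen g))"
proof -
  have "cls (gen_inv g @ gen g) = cls []"
    using pres_eq.cancel[of "QD_relations n" g False]
    by (simp add: pres_class_eq_iff gen_def gen_inv_def)
  then show ?thesis
    by (intro QD.inv_equality[symmetric]) (simp_all add: cls_append cls_Nil cls_closed)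
qed

lemma A_power_order: "cls (gen A) [^]\<^bsub>QD n\<^esub> (2 * half) = \<one>\<^bsub>QD n\<^esub>"
proof -
  have "cls (word_pow (gen A) (2 ^ (n - 1))) = cls []"
    by (rule cls_relation) (simp add: QD_relations_def)
  then show ?thesis by (simp only: cls_word_pow cls_Nil order_A)
qed

lemma B_power_2: "cls (gen B) [^]\<^bsub>QD n\<^esub> (2::nat) = \<one>\<^bsub>QD n\<^esub>"
proof -
  have "cls (word_pow (gen B) 2) = cls []"
    by (rule cls_relation) (simp add: QD_relations_def)
  then show ?thesis by (simp only: cls_word_pow cls_Nil)
qed

lemma inv_B: "inv\<^bsub>QD n\<^esub> (cls (gen B)) = cls (gen B)"
  using B_power_2 by (intro QD.inv_equality) (simp_all add: cls_closed numeral_2_eq_2)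

lemma B_conj_A: "cls (gen B) \<otimes>\<^bsub>QD n\<^esub> cls (gen A) \<otimes>\<^bsub>QD n\<^esub> inv\<^bsub>QD n\<^esub> (cls (gen B)) =
    cls (gen A) [^]\<^bsub>QD n\<^esub> r"
proof -
  have "cls (gen B @ gen A @ gen_inv B) = cls (word_pow (gen A) (2 ^ (n - 2) - 1))"
    by (rule cls_relation) (simp add: QD_relations_def)
  moreover have "r = int (2 ^ (n - 2) - 1)"
    by (simp add: r_def of_nat_diff)
  ultimately show ?thesis
    by (simp only: int_pow_int cls_word_pow cls_append cls_gen_inv)
      (simp add: cls_closed QD.m_assoc)
qed

text \<open>Conjugation by b is an endomorphism and so respects integer powers; this carries the
  defining relation from a to every power of a.\<close>

lemma B_mult_A_pow:
  "cls (gen B) \<otimes>\<^bsub>QD n\<^esub> cls (gen A) [^]\<^bsub>QD n\<^esub> (e::int) =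
    cls (gen A) [^]\<^bsub>QD n\<^esub> (r * e) \<otimes>\<^bsub>QD n\<^esub> cls (gen B)"
proof -
  let ?a = "cls (gen A)" and ?b = "cls (gen B)"
  let ?c = "\<lambda>x. ?b \<otimes>\<^bsub>QD n\<^esub> x \<otimes>\<^bsub>QD n\<^esub> inv\<^bsub>QD n\<^esub> ?b"
  have "?c \<in> hom (QD n) (QD n)"
    by (rule homI) (auto simp: cls_closed QD.m_assoc QD.inv_solve_left)
  then have "?c (?a [^]\<^bsub>QD n\<^esub> e) = ?c ?a [^]\<^bsub>QD n\<^esub> e"
    by (rule hom_int_pow) (simp_all add: cls_closed group_QD)
  then have "?c (?a [^]\<^bsub>QD n\<^esub> e) = ?a [^]\<^bsub>QD n\<^esub> (r * e)"
    by (simp only: B_conj_A QD.int_pow_pow[OF cls_closed])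
  then show ?thesis
    by (metis QD.inv_solve_right' QD.int_pow_closed QD.m_closed cls_closed)
qed

text \<open>Letters are prepended one at a time: \<open>A\<close> shifts the exponent by one, and
  \<open>B\<close> is carried past the a-power by \<open>B_mult_A_pow\<close>.\<close>

lemma cls_normal_form:
  "cls w = cls (gen A) [^]\<^bsub>QD n\<^esub> expo r w \<otimes>\<^bsub>QD n\<^esub> cls (gen B) [^]\<^bsub>QD n\<^esub> count_B w"
proof (induction w rule: count_B.induct)
  case 1
  show ?case by (simp add: cls_Nil)
next
  case (2 s w)
  have "cls ((A, s) # w) = cls [(A, s)] \<otimes>\<^bsub>QD n\<^esub> cls w"
    using cls_append[of "[(A, s)]" w] by simp
  moreover have "cls [(A, s)] = cls (gen A) [^]\<^bsub>QD n\<^esub> (if s then 1 else -1 :: int)"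
    using cls_gen_inv[of A] QD.int_pow_neg[of "cls (gen A)" 1] by (auto simp: gen_def gen_inv_def cls_closed)
  ultimately show ?case
    using 2 by (simp add: QD.m_assoc QD.int_pow_mult cls_closed)
next
  case (3 s w)
  have "cls ((B, s) # w) = cls [(B, s)] \<otimes>\<^bsub>QD n\<^esub> cls w"
    using cls_append[of "[(B, s)]" w] by simp
  moreover have "cls [(B, s)] = cls (gen B)"
    using cls_gen_inv[of B] by (cases s) (simp_all add: gen_def gen_inv_def inv_B[unfolded gen_def])
  ultimately have "cls ((B, s) # w) = cls (gen B) \<otimes>\<^bsub>QD n\<^esub> cls (gen A) [^]\<^bsub>QD n\<^esub> expo r w
      \<otimes>\<^bsub>QD n\<^esub> cls (gen B) [^]\<^bsub>QD n\<^esub> count_B w"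
    using 3 by (simp add: QD.m_assoc cls_closed)
  then show ?case
    by (simp only: B_mult_A_pow) (simp add: QD.m_assoc QD.mult_nat_pow_commute cls_closed)
qed

text \<open>This solves the word problem. The invariants separate distinct elements; conversely the
  normal form depends only on the exponents modulo \<open>2 * half\<close> and 2, since these powers
  of a and b are trivial.\<close>

lemma cls_eq_iff:
  "cls u = cls v \<longleftrightarrow>
    [expo r u = expo r v] (mod int (2 * half)) \<and> even (count_B u) = even (count_B v)"
proof
  assume "cls u = cls v"
  then show "[expo r u = expo r v] (mod int (2 * half)) \<and> even (count_B u) = even (count_B v)"
    by (intro pres_eq_invariants) (simp add: pres_class_eq_iff)
next
  assume *: "[expo r u = expo r v] (mod int (2 * half)) \<and> even (count_B u) = even (count_B v)"
  have "cls (gen A) [^]\<^bsub>QD n\<^esub> expo r u = cls (gen A) [^]\<^bsub>QD n\<^esub> expo r v"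
  proof -
    obtain k where k: "expo r u = expo r v + int (2 * half) * k"
      using * by (metis cong_iff_lin cong_sym)
    have "cls (gen A) [^]\<^bsub>QD n\<^esub> (int (2 * half) * k) = \<one>\<^bsub>QD n\<^esub>"
      by (simp only: QD.int_pow_pow[OF cls_closed, symmetric] int_pow_int A_power_order QD.int_pow_one)
    then show ?thesis
      by (simp add: k QD.int_pow_mult cls_closed)
  qed
  moreover have "cls (gen B) [^]\<^bsub>QD n\<^esub> count_B u = cls (gen B) [^]\<^bsub>QD n\<^esub> count_B v"
  proof -
    have "cls (gen B) [^]\<^bsub>QD n\<^esub> k = cls (gen B) [^]\<^bsub>QD n\<^esub> (k mod 2)" for k :: nat
    proof -
      have "cls (gen B) [^]\<^bsub>QD n\<^esub> (2 * (k div 2)) = \<one>\<^bsub>QD n\<^esub>"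
        by (simp only: QD.nat_pow_pow[OF cls_closed, symmetric] B_power_2 QD.nat_pow_one)
      then show ?thesis
        using QD.nat_pow_mult[OF cls_closed, of "gen B" "2 * (k div 2)" "k mod 2"]
        by (simp add: cls_closed)
    qed
    moreover have "count_B u mod 2 = count_B v mod 2"
      using * by (simp add: mod2_eq_if)
    ultimately show ?thesis by metis
  qed
  ultimately show "cls u = cls v"
    unfolding cls_normal_form[of u] cls_normal_form[of v] by (simp only:)
qed

section \<open>The elements a^i b^s and their commutation\<close>

definition el :: "nat \<times> nat \<Rightarrow> qd_gen word set" where
  "el p = cls (word_pow (gen A) (fst p) @ word_pow (gen B) (snd p))"

lemma el_eq_iff:
  "el p = el q \<longleftrightarrow> fst p mod (2 * half) = fst q mod (2 * half) \<and> snd p mod 2 = snd q mod 2"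
proof -
  have "even (snd p) = even (snd q) \<longleftrightarrow> snd p mod 2 = snd q mod 2"
    by presburger
  then show ?thesis
    by (simp add: el_def cls_eq_iff word_simps flip: cong_int_iff cong_def)
qed

lemma inj_on_el: "inj_on el ({..<2 * half} \<times> {..<2})"
  by (rule inj_onI) (auto simp: el_eq_iff)

lemma carrier_QD: "carrier (QD n) = el ` ({..<2 * half} \<times> {..<2})"
proof
  show "el ` ({..<2 * half} \<times> {..<2}) \<subseteq> carrier (QD n)"
    by (auto simp: el_def cls_closed)
  show "carrier (QD n) \<subseteq> el ` ({..<2 * half} \<times> {..<2})"
  proof
    fix x assume "x \<in> carrier (QD n)"
    then obtain w where w: "x = cls w"
      by (auto simp: QD_def presented_group_def)
    \<comment> \<open>The exponents of the normal form of \<open>w\<close>, reduced to their ranges;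
      \<open>nat\<close> loses nothing because the residue is nonnegative.\<close>
    define p where "p = (nat (expo r w mod int (2 * half)), count_B w mod 2)"
    have "x = el p"
      using half_ge unfolding w el_def cls_eq_iff p_def
      by (auto simp: word_simps cong_def)
    moreover have "p \<in> {..<2 * half} \<times> {..<2}"
      using half_ge by (simp add: p_def nat_less_iff)
    ultimately show "x \<in> el ` ({..<2 * half} \<times> {..<2})"
      by blast
  qed
qed

text \<open>Both products contain equally many letters \<open>B\<close>, so they agree iff their
  exponents do modulo \<open>2 * half\<close>. The difference of the exponents is zero if s = t = 0
  and otherwise a multiple of r - 1, to which \<open>r_minus_one_dvd_iff\<close> applies.\<close>

lemma el_commute_iff:
  assumes "s < 2" "t < 2"
  shows "el (i, s) \<otimes>\<^bsub>QD n\<^esub> el (j, t) = el (j, t) \<otimes>\<^bsub>QD n\<^esub> el (i, s) \<longleftrightarrow>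
    (s = 1 \<longrightarrow> int half dvd int j \<or> t = 1) \<and> (t = 1 \<longrightarrow> int half dvd int i \<or> s = 1) \<and>
    (s = 1 \<longrightarrow> t = 1 \<longrightarrow> int half dvd int i - int j)"
proof -
  have comm: "el (i, s) \<otimes>\<^bsub>QD n\<^esub> el (j, t) = el (j, t) \<otimes>\<^bsub>QD n\<^esub> el (i, s) \<longleftrightarrow>
      int (2 * half) dvd (int i + r ^ s * int j) - (int j + r ^ t * int i)"
    by (auto simp: el_def cls_eq_iff word_simps cong_iff_dvd_diff
        simp flip: cls_append)
  have "s = 0 \<or> s = 1" "t = 0 \<or> t = 1"
    using assms by auto
  then consider "s = 0" "t = 0" | "s = 1" "t = 0" | "s = 0" "t = 1" | "s = 1" "t = 1"
    by blast
  then show ?thesis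
  proof cases
    case 1
    then show ?thesis unfolding comm by simp
  next
    case 2
    have "(int i + r ^ s * int j) - (int j + r ^ t * int i) = (r - 1) * int j"
      using 2 by (simp add: algebra_simps)
    then show ?thesis
      unfolding comm by (simp only: r_minus_one_dvd_iff) (use 2 in simp)
  next
    case 3
    have "(int i + r ^ s * int j) - (int j + r ^ t * int i) = (r - 1) * (- int i)"
      using 3 by (simp add: algebra_simps)
    then show ?thesis
      unfolding comm by (simp only: r_minus_one_dvd_iff) (use 3 in simp)
  next
    case 4
    have "(int i + r ^ s * int j) - (int j + r ^ t * int i) = (r - 1) * (- (int i - int j))"
      using 4 by (simp add: algebra_simps)
    then show ?thesis
      unfolding comm by (simp only: r_minus_one_dvd_iff dvd_minus_iff) (use 4 in simp)
  qed
qed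

lemma half_dvd_iff:
  assumes "i < 2 * half"
  shows "half dvd i \<longleftrightarrow> i = 0 \<or> i = half"
proof
  assume "half dvd i"
  then obtain k where "i = half * k" ..
  with assms half_ge have "k < 2" by simp
  with \<open>i = half * k\<close> show "i = 0 \<or> i = half"
    by (auto simp: less_2_cases_iff)
qed auto

subsection \<open>The commuting graph\<close>

definition noncentral :: "(nat \<times> nat) set" where
  "noncentral = {(i, s). i < 2 * half \<and> s < 2 \<and> (s = 0 \<longrightarrow> i \<noteq> 0 \<and> i \<noteq> half)}"

lemma el_central_iff:
  assumes "i < 2 * half" "s < 2"
  shows "el (i, s) \<in> group_center (QD n) \<longleftrightarrow> s = 0 \<and> (i = 0 \<or> i = half)"
proof -
  let ?C = "{..<2 * half} \<times> {..<2::nat}"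
  have s: "s = 0 \<or> s = 1" using assms(2) by auto
  have mem: "el (i, s) \<in> carrier (QD n)"
    unfolding carrier_QD using assms by (intro imageI) simp
  have "el (i, s) \<in> group_center (QD n) \<longleftrightarrow>
      (\<forall>x\<in>carrier (QD n). el (i, s) \<otimes>\<^bsub>QD n\<^esub> x = x \<otimes>\<^bsub>QD n\<^esub> el (i, s))"
    by (simp only: group_center_def mem_Collect_eq mem simp_thms)
  also have "\<dots> \<longleftrightarrow> (\<forall>p\<in>?C. el (i, s) \<otimes>\<^bsub>QD n\<^esub> el p = el p \<otimes>\<^bsub>QD n\<^esub> el (i, s))"
    by (simp only: carrier_QD ball_simps)
  also have "\<dots> \<longleftrightarrow> s = 0 \<and> half dvd i"
  proof
    assume c: "\<forall>p\<in>?C. el (i, s) \<otimes>\<^bsub>QD n\<^esub> el p = el p \<otimes>\<^bsub>QD n\<^esub> el (i, s)"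
    \<comment> \<open>These pairs are a and b. Commuting with a excludes s = 1, as h does not divide
      1; commuting with b then forces h to divide i.\<close>
    have "(1, 0) \<in> ?C" "(0, 1) \<in> ?C" using half_ge by auto
    from this[THEN c[rule_format]] show "s = 0 \<and> half dvd i"
      using s half_ge assms(2) by (auto simp: el_commute_iff)
  next
    assume "s = 0 \<and> half dvd i"
    then show "\<forall>p\<in>?C. el (i, s) \<otimes>\<^bsub>QD n\<^esub> el p = el p \<otimes>\<^bsub>QD n\<^esub> el (i, s)"
      by (auto simp: el_commute_iff)
  qed
  finally show ?thesis
    by (simp only: half_dvd_iff[OF assms(1)])
qed

lemma pverts_commuting_graph: "pverts (commuting_graph (QD n)) = el ` noncentral"
proof -
  have "noncentral = {p \<in> {..<2 * half} \<times> {..<2}. el p \<notin> group_center (QD n)}"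
    by (auto simp: noncentral_def el_central_iff)
  then show ?thesis
    unfolding commuting_graph_def carrier_QD by auto
qed

text \<open>The mixed cases of \<open>el_commute_iff\<close> drop out: a noncentral power of a has
  an exponent not divisible by h.\<close>

lemma parcs_commuting_graph:
  assumes "(i, s) \<in> noncentral" "(j, t) \<in> noncentral"
  shows "(el (i, s), el (j, t)) \<in> parcs (commuting_graph (QD n)) \<longleftrightarrow>
    (i, s) \<noteq> (j, t) \<and> s = t \<and> (s = 1 \<longrightarrow> i mod half = j mod half)"
proof -
  have "(el (i, s), el (j, t)) \<in> parcs (commuting_graph (QD n)) \<longleftrightarrow>
      el (i, s) \<noteq> el (j, t) \<and> el (i, s) \<otimes>\<^bsub>QD n\<^esub> el (j, t) = el (j, t) \<otimes>\<^bsub>QD n\<^esub> el (i, s)"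
  proof -
    have "el (i, s) \<in> pverts (commuting_graph (QD n))" "el (j, t) \<in> pverts (commuting_graph (QD n))"
      using assms by (simp_all add: pverts_commuting_graph)
    then show ?thesis by (simp add: commuting_graph_def)
  qed
  also have "el (i, s) \<noteq> el (j, t) \<longleftrightarrow> (i, s) \<noteq> (j, t)"
    using assms by (subst inj_on_eq_iff[OF inj_on_el]) (auto simp: noncentral_def)
  also have "el (i, s) \<otimes>\<^bsub>QD n\<^esub> el (j, t) = el (j, t) \<otimes>\<^bsub>QD n\<^esub> el (i, s) \<longleftrightarrow>
      s = t \<and> (s = 1 \<longrightarrow> i mod half = j mod half)"
  proof -
    have "int half dvd int i - int j \<longleftrightarrow> i mod half = j mod half"
      by (metis cong_iff_dvd_diff cong_int_iff cong_def)
    moreover have "s = 0 \<or> s = 1" "t = 0 \<or> t = 1" "s < 2" "t < 2"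
      using assms by (auto simp: noncentral_def)
    moreover have "s = 0 \<Longrightarrow> \<not> half dvd i" "t = 0 \<Longrightarrow> \<not> half dvd j"
      using assms half_dvd_iff by (auto simp: noncentral_def)
    ultimately show ?thesis
      by (auto simp: el_commute_iff)
  qed
  finally show ?thesis .
qed

text \<open>The list form matches \<open>eigenvalue_mset_adjacency_cliques\<close>. The first list
  skips the exponents 0 and \<open>half\<close> of the central elements.\<close>

definition cliques :: "(nat \<times> nat) list list" where
  "cliques = map (\<lambda>i. (i, 0)) ([1..<half] @ [half + 1..<2 * half]) #
    map (\<lambda>i. [(i, 1), (i + half, 1)]) [0..<half]"

lemma set_concat_cliques: "set (concat cliques) = noncentral"
proof -
  have "set (concat cliques) = ({1..<half} \<union> {half + 1..<2 * half}) \<times> {0} \<union>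
      ({..<half} \<union> (\<lambda>i. i + half) ` {..<half}) \<times> {1}"
    by (auto simp: cliques_def)
  also have "(\<lambda>i. i + half) ` {..<half} = {half..<2 * half}"
    using image_add_atLeastLessThan'[of half 0 half] by (simp add: lessThan_atLeast0 mult_2)
  also have "({1..<half} \<union> {half + 1..<2 * half}) \<times> {0} \<union>
      ({..<half} \<union> {half..<2 * half}) \<times> {1} = noncentral"
    by (auto simp: noncentral_def)
  finally show ?thesis .
qed

lemma distinct_concat_cliques: "distinct (concat cliques)"
proof -
  \<comment> \<open>Any distinct \<open>xs\<close> is allowed for the sake of the induction; the
    range condition keeps every i + half apart from all entries.\<close>
  have "distinct (concat (map (\<lambda>i. [(i, Suc 0), (i + half, Suc 0)]) xs))"
    if "distinct xs" "set xs \<subseteq> {0..<half}" for xs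
    using that by (induction xs) (auto simp: subset_iff)
  from this[of "[0..<half]"] have
    "distinct (concat (map (\<lambda>i. [(i, Suc 0), (i + half, Suc 0)]) [0..<half]))"
    by auto
  then show ?thesis
    by (auto simp: cliques_def distinct_map inj_on_def)
qed

lemma same_clique_iff:
  assumes "(i, s) \<in> noncentral" "(j, t) \<in> noncentral"
  shows "(\<exists>c\<in>set cliques. (i, s) \<in> set c \<and> (j, t) \<in> set c) \<longleftrightarrow>
    s = t \<and> (s = 1 \<longrightarrow> i mod half = j mod half)"
proof -
  define c where "c = map (\<lambda>i. (i, 0::nat)) ([1..<half] @ [half + 1..<2 * half])"
  have cliques: "cliques = c # map (\<lambda>k. [(k, 1), (k + half, 1)]) [0..<half]"
    by (simp add: cliques_def c_def)
  have first: "(i, s) \<in> set c \<longleftrightarrow> s = 0"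
    if "(i, s) \<in> noncentral" for i s
    using that by (auto simp: c_def noncentral_def image_iff)
  \<comment> \<open>Below \<open>2 * half\<close> only k and k + half have residue k modulo
    \<open>half\<close>, so the residue of i names its pair.\<close>
  have pair: "(i, s) \<in> set [(k, 1), (k + half, 1)] \<longleftrightarrow> s = 1 \<and> k = i mod half"
    if "(i, s) \<in> noncentral" "k < half" for i s k
  proof -
    have "i < 2 * half"
      using that by (simp add: noncentral_def)
    then have "i mod half = (if i < half then i else i - half)"
      by (simp add: mod_if)
    then show ?thesis
      using that(2) \<open>i < 2 * half\<close> by auto
  qed
  have "(\<exists>c\<in>set cliques. (i, s) \<in> set c \<and> (j, t) \<in> set c) \<longleftrightarrow>
      s = 0 \<and> t = 0 \<or> (\<exists>k<half. (s = 1 \<and> k = i mod half) \<and> (t = 1 \<and> k = j mod half))"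
    using first[OF assms(1)] first[OF assms(2)] pair[OF assms(1)] pair[OF assms(2)]
    unfolding cliques list.set(2) bex_simps set_map set_upt by (metis atLeastLessThan_iff le0)
  also have "\<dots> \<longleftrightarrow> s = t \<and> (s = 1 \<longrightarrow> i mod half = j mod half)"
  proof -
    have "s = 0 \<or> s = 1" "t = 0 \<or> t = 1" "i mod half < half"
      using assms half_ge by (auto simp: noncentral_def)
    then show ?thesis by auto
  qed
  finally show ?thesis .
qed

section \<open>The spectrum from the clique sizes\<close>

lemma graph_spectrum_QD:
  "graph_spectrum (commuting_graph (QD n)) =
    add_mset (of_nat (2 * half - 2) - 1) (replicate_mset (2 * half - 3) (-1)) +
    replicate_mset half 1 + replicate_mset half (-1)"
proof -
  let ?D = "commuting_graph (QD n)"
  let ?cs = "map (map el) cliques"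
  have concat: "concat ?cs = map el (concat cliques)"
    by (simp add: map_concat)
  have inj: "inj_on el noncentral"
    by (rule inj_on_subset[OF inj_on_el]) (auto simp: noncentral_def)
  have dist: "distinct (concat ?cs)"
    unfolding concat distinct_map set_concat_cliques
    using distinct_concat_cliques inj by simp
  have verts: "set (concat ?cs) = pverts ?D"
    unfolding concat pverts_commuting_graph set_map set_concat_cliques ..
  have nonempty: "[] \<notin> set ?cs"
    using half_ge by (auto simp: cliques_def)
  \<comment> \<open>Injectivity of \<open>el\<close> moves the claim to exponent pairs, where
    adjacency and sharing a clique amount to the same congruence condition.\<close>
  have arcs: "(x, y) \<in> parcs ?D \<longleftrightarrow> x \<noteq> y \<and> (\<exists>c\<in>set ?cs. x \<in> set c \<and> y \<in> set c)"
    if xy: "x \<in> set (concat ?cs)" "y \<in> set (concat ?cs)" for x y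
  proof -
    obtain p q where p: "p \<in> noncentral" "x = el p" and q: "q \<in> noncentral" "y = el q"
      using xy unfolding concat set_map set_concat_cliques by blast
    have sub: "set c \<subseteq> noncentral" if "c \<in> set cliques" for c
      using that set_concat_cliques by auto
    have mem: "el p \<in> el ` set c \<longleftrightarrow> p \<in> set c" if "c \<in> set cliques" "p \<in> noncentral" for c p
      using inj_on_image_mem_iff[OF inj that(2) sub[OF that(1)]] .
    have "(\<exists>c\<in>set ?cs. x \<in> set c \<and> y \<in> set c) \<longleftrightarrow> (\<exists>c\<in>set cliques. p \<in> set c \<and> q \<in> set c)"
      using mem p q by auto
    moreover have "x = y \<longleftrightarrow> p = q"
      using p q inj by (simp add: inj_on_eq_iff)
    ultimately show ?thesis
      using p q parcs_commuting_graph[of "fst p" "snd p" "fst q" "snd q"]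
        same_clique_iff[of "fst p" "snd p" "fst q" "snd q"] by auto
  qed
  have "graph_spectrum ?D =
      (\<Sum>c\<leftarrow>?cs. add_mset (of_nat (length c) - 1) (replicate_mset (length c - 1) (-1)))"
    unfolding graph_spectrum_eq[OF dist verts]
    by (rule eigenvalue_mset_adjacency_cliques[OF dist nonempty arcs])
  also have "\<dots> = add_mset (of_nat (2 * half - 2) - 1) (replicate_mset (2 * half - 3) (-1)) +
      (\<Sum>i\<leftarrow>[0..<half]. {#1, -1#})"
  proof -
    \<comment> \<open>The size of the first clique, as the sum of the lengths of its two exponent
      ranges.\<close>
    have "half - 1 + (2 * half - (half + 1)) = 2 * half - 2"
      using half_ge by simp
    then show ?thesis
      by (simp add: cliques_def o_def)
  qed
  \<comment> \<open>Each two-vertex clique contributes 1 and -1; a general \<open>xs\<close> permits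
    induction.\<close>
  also have "(\<Sum>i\<leftarrow>xs. {#1, -1#}) =
      replicate_mset (length xs) 1 + replicate_mset (length xs) (-1 :: complex)" for xs :: "nat list"
    by (induction xs) auto
  finally show ?thesis by (simp add: add.assoc)
qed

end

theorem proposition2p4:
  fixes n :: nat
  assumes "n \<ge> 4"
  shows "graph_spectrum (commuting_graph (QD n)) =
    replicate_mset (2 ^ n - 2 ^ (n - 2) - 3) (-1) +
    replicate_mset (2 ^ (n - 2)) 1 +
    replicate_mset 1 (2 ^ (n - 1) - 3)"
proof -
  interpret quasidihedral n
    by unfold_locales (rule assms)
  have pow: "(2::nat) ^ n = 4 * half"
    using order_A assms by (cases n) simp_all
  have "(2::complex) ^ (n - 1) = of_nat (2 * half)"
    unfolding order_A[symmetric] by simp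
  then have "of_nat (2 * half - 2) - 1 = (2::complex) ^ (n - 1) - 3"
    using half_ge by (simp add: of_nat_diff)
  \<comment> \<open>The large clique gives \<open>2 * half - 3\<close> copies of -1 and each of the
    \<open>half\<close> pairs one more.\<close>
  moreover have "2 ^ n - 2 ^ (n - 2) - 3 = (2 * half - 3) + half"
    using half_ge unfolding pow half_def[symmetric] by simp
  moreover have "replicate_mset (k + l) x = replicate_mset k x + replicate_mset l x"
    for k l and x :: complex
    by (induction k) auto
  ultimately show ?thesis
    unfolding graph_spectrum_QD half_def[symmetric] by simp
qed

end
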